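(* Fix a player set $N=\{1,\dots,n\}$ with $n\ge2$. The position value $\pi$ is the unique allocation rule $f$ on the class $HCS^N$ of all hypergraph communication situations with player set $N$ that satisfies both component efficiency and partial balanced conference contributions.
   Context: A TU-game is a pair $(N,v)$ with $N$ a finite player set and $v:2^N\to\mathbf{R}$ with $v(\emptyset)=0$; it is zero-normalized if $v(\{i\})=0$ for all $i\in N$. The Shapley value of $(N,v)$ is $Sh_i(N,v)=\frac{1}{|\Sigma(N)|}\sum_{\sigma\in\Sigma(N)}\big(v(\sigma^i\cup\{i\})-v(\sigma^i)\big)$, where $\Sigma(N)$ is the set of permutations of $N$ and $\sigma^i=\{j\in N\mid\sigma(j)<\sigma(i)\}$. A hypergraph communication situation is a triple $(N,v,H)$ where $(N,v)$ is a zero-normalized TU-game and $H\subseteq\{e\subseteq N\mid |e|>1\}$ is a set of hyperlinks; $HCS^N$ is the class of all of them with fixed player set $N$. For $i\in N$, $H_i=\{e\in H\mid i\in e\}$. For $H'\subseteq H$, two nodes are adjacent in $(N,H')$ if some hyperlink of $H'$ contains both; two nodes are connected if they are joined by a finite sequence of nodes with consecutive ones adjacent (each node is connected to itself); $N/H'$ is the set of components (maximal sets of pairwise connected nodes) of $(N,H')$. The hyperlink game $(H,v^N)$ has player set $H$ and $v^N(H')=\sum_{T\in N/H'}v(T)$ for $H'\subseteq H$. The position value is $\pi_i(N,v,H)=\sum_{e\in H_i}\frac{1}{|e|}Sh_e(H,v^N)$ for $i\in N$. An allocation rule $f$ assigns to each $(N,v,H)\in HCS^N$ a vector $f(N,v,H)\in\mathbf{R}^N$.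 Component efficiency: for any $(N,v,H)\in HCS^N$ and any $T\in N/H$, $\sum_{i\in T}f_i(N,v,H)=v(T)$. Partial balanced conference contributions: for any $(N,v,H)\in HCS^N$ and any $i,j\in N$, $$\sum_{e\in H_j}\frac{1}{|e|}\big[f_i(N,v,H)-f_i(N,v,H\setminus\{e\})\big]=\sum_{e\in H_i}\frac{1}{|e|}\big[f_j(N,v,H)-f_j(N,v,H\setminus\{e\})\big].$$ *)

theory Defs
  imports Complex_Main "HOL-Library.FuncSet"
begin

(* Functions with a restricted domain are extensional (undefined outside the domain), so that
   equality of games and of allocation rules is equality of HOL functions. *)

definition tu_game :: "'a set \<Rightarrow> ('a set \<Rightarrow> real) \<Rightarrow> bool" where
  "tu_game N v \<longleftrightarrow> finite N \<and> v \<in> Pow N \<rightarrow>\<^sub>E UNIV \<and> v {} = 0"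

definition zero_normalized :: "'a set \<Rightarrow> ('a set \<Rightarrow> real) \<Rightarrow> bool" where
  "zero_normalized N v \<longleftrightarrow> (\<forall>i\<in>N. v {i} = 0)"

(* A permutation of a player set that need not consist of numbers assigns to each player its
   position, so it is a bijection onto {1..card N}. *)
definition player_orders :: "'a set \<Rightarrow> ('a \<Rightarrow> nat) set" where
  "player_orders N = {\<sigma> \<in> N \<rightarrow>\<^sub>E {1..card N}. bij_betw \<sigma> N {1..card N}}"

definition predecessors :: "'a set \<Rightarrow> ('a \<Rightarrow> nat) \<Rightarrow> 'a \<Rightarrow> 'a set" where
  "predecessors N \<sigma> i = {j \<in> N. \<sigma> j < \<sigma> i}"

definition shapley_value :: "'a set \<Rightarrow> ('a set \<Rightarrow> real) \<Rightarrow> 'a \<Rightarrow> real" where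
  "shapley_value N v i =
     (1 / real (card (player_orders N))) *
     (\<Sum>\<sigma>\<in>player_orders N. v (predecessors N \<sigma> i \<union> {i}) - v (predecessors N \<sigma> i))"

(* The class HCS of situations with player set N; the fixed component N is left out of the triples. *)
definition HCS :: "'a set \<Rightarrow> (('a set \<Rightarrow> real) \<times> 'a set set) set" where
  "HCS N = {(v, H). tu_game N v \<and> zero_normalized N v \<and> H \<subseteq> {e. e \<subseteq> N \<and> card e > 1}}"

definition links_of :: "'a set set \<Rightarrow> 'a \<Rightarrow> 'a set set" where
  "links_of H i = {e \<in> H. i \<in> e}"

definition adjacent_nodes :: "'a set \<Rightarrow> 'a set set \<Rightarrow> 'a \<Rightarrow> 'a \<Rightarrow> bool" where
  "adjacent_nodes N H i j \<longleftrightarrow> i \<in> N \<and> j \<in> N \<and> (\<exists>e\<in>H. i \<in> e \<and> j \<in> e)"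

definition connected_nodes :: "'a set \<Rightarrow> 'a set set \<Rightarrow> 'a \<Rightarrow> 'a \<Rightarrow> bool" where
  "connected_nodes N H = (adjacent_nodes N H)\<^sup>*\<^sup>*"

definition pairwise_connected :: "'a set \<Rightarrow> 'a set set \<Rightarrow> 'a set \<Rightarrow> bool" where
  "pairwise_connected N H T \<longleftrightarrow> T \<subseteq> N \<and> (\<forall>i\<in>T. \<forall>j\<in>T. connected_nodes N H i j)"

definition node_components :: "'a set \<Rightarrow> 'a set set \<Rightarrow> 'a set set" where
  "node_components N H =
     {T. pairwise_connected N H T \<and> (\<forall>S. T \<subseteq> S \<and> pairwise_connected N H S \<longrightarrow> S = T)}"

definition hyperlink_game ::
  "'a set \<Rightarrow> ('a set \<Rightarrow> real) \<Rightarrow> 'a set set \<Rightarrow> 'a set set \<Rightarrow> real" where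
  "hyperlink_game N v H = (\<lambda>H'\<in>Pow H. \<Sum>T\<in>node_components N H'. v T)"

definition allocation_rules ::
  "'a set \<Rightarrow> (('a set \<Rightarrow> real) \<times> 'a set set \<Rightarrow> 'a \<Rightarrow> real) set" where
  "allocation_rules N = HCS N \<rightarrow>\<^sub>E (N \<rightarrow>\<^sub>E UNIV)"

definition position_value ::
  "'a set \<Rightarrow> ('a set \<Rightarrow> real) \<times> 'a set set \<Rightarrow> 'a \<Rightarrow> real" where
  "position_value N =
     (\<lambda>(v, H)\<in>HCS N. \<lambda>i\<in>N.
        \<Sum>e\<in>links_of H i. (1 / real (card e)) * shapley_value H (hyperlink_game N v H) e)"

definition component_efficient ::
  "'a set \<Rightarrow> (('a set \<Rightarrow> real) \<times> 'a set set \<Rightarrow> 'a \<Rightarrow> real) \<Rightarrow> bool" where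
  "component_efficient N f \<longleftrightarrow>
     (\<forall>(v, H)\<in>HCS N. \<forall>T\<in>node_components N H. (\<Sum>i\<in>T. f (v, H) i) = v T)"

definition partial_balanced_conference_contributions ::
  "'a set \<Rightarrow> (('a set \<Rightarrow> real) \<times> 'a set set \<Rightarrow> 'a \<Rightarrow> real) \<Rightarrow> bool" where
  "partial_balanced_conference_contributions N f \<longleftrightarrow>
     (\<forall>(v, H)\<in>HCS N. \<forall>i\<in>N. \<forall>j\<in>N.
        (\<Sum>e\<in>links_of H j. (1 / real (card e)) * (f (v, H) i - f (v, H - {e}) i)) =
        (\<Sum>e\<in>links_of H i. (1 / real (card e)) * (f (v, H) j - f (v, H - {e}) j)))"

end

theory Submission
  imports Defs
begin

text \<open>
  Uniqueness is by induction on the number of hyperlinks. If two rules agree on all smaller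
  situations, their difference \<open>d\<close> at \<open>(v, H)\<close> satisfies \<open>w\<^sub>j d\<^sub>i = w\<^sub>i d\<^sub>j\<close> with \<open>w\<^sub>i\<close> the sum of
  \<open>1 / |e|\<close> over the links at \<open>i\<close>, and sums to zero over each component; as \<open>w\<^sub>j = 0\<close> only for
  isolated nodes, \<open>d = 0\<close>.

  For existence, partial balanced conference contributions of the position value reduce to Myerson's
  balanced contributions of the Shapley value. The latter, as well as efficiency of the Shapley value,
  follow by induction from the recursion obtained by conditioning on the last player of an order.
  Component efficiency holds because the hyperlink game is the sum of a game that only depends on the
  links inside a given component and a game that only depends on the links outside it.
\<close>

section \<open>The Shapley value\<close>

lemma predecessors_insert_last:
  assumes "finite N" "j \<in> N" "\<tau> \<in> player_orders (N - {j})" "i \<in> N"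
  shows "predecessors N (\<tau>(j := card N)) i =
    (if i = j then N - {j} else predecessors (N - {j}) \<tau> i)"
proof -
  have less: "\<tau> k < card N" if "k \<in> N" "k \<noteq> j" for k
  proof -
    have "\<tau> k \<in> {1..card (N - {j})}"
      using assms(3) that PiE_mem[of \<tau> "N - {j}" "\<lambda>_. {1..card (N - {j})}" k]
      by (simp add: player_orders_def)
    then show ?thesis
      using card_Diff1_less[OF assms(1,2)] by simp
  qed
  show ?thesis
  proof (cases "i = j")
    case True
    then show ?thesis
      using less by (auto simp: predecessors_def)
  next
    case False
    then show ?thesis
      using less[OF assms(4)] by (auto simp: predecessors_def)
  qed
qed

lemma player_order_insert_last:
  assumes "finite N" "j \<in> N" "\<tau> \<in> player_orders (N - {j})"
  shows "\<tau>(j := card N) \<in> player_orders N"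
proof -
  obtain m where m: "card N = Suc m" "card (N - {j}) = m"
    using assms by (metis card_Suc_Diff1)
  have \<tau>: "bij_betw \<tau> (N - {j}) {1..m}" "\<tau> \<in> (N - {j}) \<rightarrow>\<^sub>E {1..m}"
    using assms(3) m by (auto simp: player_orders_def)
  have "bij_betw (\<tau>(j := Suc m)) (N - {j}) {1..m}"
    using \<tau>(1) by (rule bij_betw_cong[THEN iffD1, rotated]) auto
  then have "bij_betw (\<tau>(j := Suc m)) (N - {j} \<union> {j}) ({1..m} \<union> {Suc m})"
    using notIn_Un_bij_betw[of j "N - {j}" "\<tau>(j := Suc m)" "{1..m}"] by simp
  moreover have "N - {j} \<union> {j} = N" "{1..m} \<union> {Suc m} = {1..Suc m}"
    using assms by auto
  ultimately have bij: "bij_betw (\<tau>(j := Suc m)) N {1..Suc m}" by simp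
  moreover have "\<tau>(j := Suc m) \<in> N \<rightarrow>\<^sub>E {1..Suc m}"
    using bij \<tau>(2) assms(2) by (auto simp: bij_betw_def PiE_iff extensional_def)
  ultimately show ?thesis
    using m by (simp add: player_orders_def)
qed

lemma player_order_remove_last:
  assumes "finite N" "j \<in> N" "\<sigma> \<in> player_orders N" "\<sigma> j = card N"
  shows "restrict \<sigma> (N - {j}) \<in> player_orders (N - {j})"
proof -
  obtain m where m: "card N = Suc m" "card (N - {j}) = m"
    using assms by (metis card_Suc_Diff1)
  have "bij_betw \<sigma> N {1..Suc m}"
    using assms(3) m by (simp add: player_orders_def)
  then have "bij_betw \<sigma> (N - {j}) ({1..Suc m} - {Suc m})"
    using assms m by (intro bij_betw_DiffI bij_betw_singletonI) auto
  moreover have "{1..Suc m} - {Suc m} = {1..m}" by auto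
  ultimately have "bij_betw (restrict \<sigma> (N - {j})) (N - {j}) {1..m}"
    by simp
  then show ?thesis
    using m by (auto simp: player_orders_def bij_betw_def)
qed

text \<open>An order of a nonempty \<open>N\<close> amounts to its last player \<open>j\<close>
  together with an order of \<open>N - {j}\<close>.\<close>

lemma sum_player_orders_last:
  fixes g :: "('a \<Rightarrow> nat) \<Rightarrow> real"
  assumes "finite N" "N \<noteq> {}"
  shows "(\<Sum>\<sigma>\<in>player_orders N. g \<sigma>) =
    (\<Sum>j\<in>N. \<Sum>\<tau>\<in>player_orders (N - {j}). g (\<tau>(j := card N)))"
proof -
  have fin: "finite (player_orders (N - {j}))" for j
    unfolding player_orders_def using assms(1)
    by (intro finite_subset[OF _ finite_PiE[of "N - {j}" "\<lambda>_. {1..card (N - {j})}"]]) auto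
  \<comment> \<open>Since \<open>N\<close> is nonempty, \<open>card N\<close> is one of the
    positions, so \<open>inv_into N \<sigma> (card N)\<close> really is the last player.\<close>
  have last: "inv_into N \<sigma> (card N) \<in> N \<and> \<sigma> (inv_into N \<sigma> (card N)) = card N"
    if "\<sigma> \<in> player_orders N" for \<sigma>
  proof -
    have "card N \<in> \<sigma> ` N"
      using that assms by (auto simp: player_orders_def bij_betw_def Suc_le_eq card_gt_0_iff)
    then show ?thesis
      by (simp add: inv_into_into f_inv_into_f)
  qed
  have "(\<Sum>j\<in>N. \<Sum>\<tau>\<in>player_orders (N - {j}). g (\<tau>(j := card N))) =
      (\<Sum>(j, \<tau>)\<in>(SIGMA j:N. player_orders (N - {j})). g (\<tau>(j := card N)))"
    using assms fin by (intro sum.Sigma) auto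
  also have "\<dots> = (\<Sum>\<sigma>\<in>player_orders N. g \<sigma>)"
  proof (rule sum.reindex_bij_witness[where j = "\<lambda>(j, \<tau>). \<tau>(j := card N)"
        and i = "\<lambda>\<sigma>. (inv_into N \<sigma> (card N), restrict \<sigma> (N - {inv_into N \<sigma> (card N)}))"],
      goal_cases)
    case (1 p)
    then obtain j \<tau> where p: "p = (j, \<tau>)" "j \<in> N" "\<tau> \<in> player_orders (N - {j})" by auto
    have "\<tau>(j := card N) \<in> player_orders N"
      using player_order_insert_last[OF assms(1) p(2,3)] .
    then have "inj_on (\<tau>(j := card N)) N"
      by (simp add: player_orders_def bij_betw_def)
    then have "inv_into N (\<tau>(j := card N)) (card N) = j"
      using p(2) inv_into_f_f[of "\<tau>(j := card N)" N j] by simp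
    moreover have "restrict (\<tau>(j := card N)) (N - {j}) = \<tau>"
    proof -
      have "restrict (\<tau>(j := card N)) (N - {j}) = restrict \<tau> (N - {j})"
        by (rule restrict_ext) auto
      also have "\<dots> = \<tau>"
        using p(3) unfolding player_orders_def by (blast intro: PiE_restrict)
      finally show ?thesis .
    qed
    ultimately show ?case using p by simp
  next
    case (2 p)
    then show ?case using player_order_insert_last assms by force
  next
    case (3 \<sigma>)
    \<comment> \<open>Restricting and updating must also give back the value
      \<open>undefined\<close> outside \<open>N\<close>.\<close>
    have "\<sigma> x = undefined" if "x \<notin> N" for x
      using 3 that by (auto simp: player_orders_def PiE_iff extensional_def)
    then show ?case
      using last[OF 3] by (auto simp: fun_eq_iff restrict_def)
  next
    case (4 \<sigma>)
    then show ?case using last[OF 4] player_order_remove_last assms by force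
  next
    case (5 p)
    then show ?case by auto
  qed
  finally show ?thesis by simp
qed

lemma card_player_orders:
  assumes "finite N"
  shows "card (player_orders N) = fact (card N)"
  using assms
proof (induction "card N" arbitrary: N)
  case 0
  then have "player_orders N = {\<lambda>_. undefined}"
    by (auto simp: player_orders_def bij_betw_def)
  then show ?case using 0 by simp
next
  case (Suc m)
  have "card (player_orders (N - {j})) = fact m" if "j \<in> N" for j
    using Suc that by (metis card_Diff_singleton diff_Suc_1 finite_Diff)
  moreover have "N \<noteq> {}" using Suc by auto
  \<comment> \<open>The count is a sum of ones, taken in the reals because the decomposition is
    stated for real sums; it is transferred back at the end.\<close>
  ultimately have "real (card (player_orders N)) = real (Suc m) * fact m"
    using sum_player_orders_last[OF Suc.prems, where g = "\<lambda>_. 1"] Suc.hyps(2)[symmetric] by simp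
  then have "real (card (player_orders N)) = real (fact (Suc m))" by (simp add: algebra_simps)
  then show ?case
    using Suc.hyps(2) by (metis of_nat_eq_iff)
qed

section \<open>Recursion, efficiency and balanced contributions of the Shapley value\<close>

text \<open>All players are equally likely to come last. If \<open>i\<close> does, it contributes
  \<open>v N - v (N - {i})\<close>; if some other \<open>j\<close> does, \<open>i\<close> faces an
  order of \<open>N - {j}\<close>. There \<open>v\<close> is evaluated only at subsets of
  \<open>N - {j}\<close>, so the subgame is \<open>v\<close> itself with a smaller player
  set.\<close>

lemma shapley_value_recursion:
  assumes "finite N" "i \<in> N"
  shows "real (card N) * shapley_value N v i =
    v N - v (N - {i}) + (\<Sum>j\<in>N - {i}. shapley_value (N - {j}) v i)"
proof -
  obtain m where m: "card N = Suc m"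
    using assms by (metis card_Suc_Diff1)
  let ?M = "\<lambda>K \<sigma>. v (predecessors K \<sigma> i \<union> {i}) - v (predecessors K \<sigma> i)"
  have card: "card (player_orders (N - {j})) = fact m" if "j \<in> N" for j
    using card_player_orders[of "N - {j}"] assms(1) that m by simp
  have "(\<Sum>\<sigma>\<in>player_orders N. ?M N \<sigma>) =
      (\<Sum>j\<in>N. \<Sum>\<tau>\<in>player_orders (N - {j}). ?M N (\<tau>(j := card N)))"
    using assms by (intro sum_player_orders_last) auto
  also have "\<dots> = (\<Sum>j\<in>N. fact m *
      (if j = i then v N - v (N - {i}) else shapley_value (N - {j}) v i))"
  proof (rule sum.cong[OF refl])
    fix j assume j: "j \<in> N"
    show "(\<Sum>\<tau>\<in>player_orders (N - {j}). ?M N (\<tau>(j := card N))) = fact m *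
      (if j = i then v N - v (N - {i}) else shapley_value (N - {j}) v i)"
    proof (cases "j = i")
      case True
      have "(\<Sum>\<tau>\<in>player_orders (N - {j}). ?M N (\<tau>(j := card N))) =
          (\<Sum>\<tau>\<in>player_orders (N - {j}). v N - v (N - {i}))"
        using True assms j
        by (intro sum.cong) (auto simp: predecessors_insert_last insert_absorb)
      then show ?thesis using True card[OF j] by simp
    next
      case False
      have "(\<Sum>\<tau>\<in>player_orders (N - {j}). ?M N (\<tau>(j := card N))) =
          (\<Sum>\<tau>\<in>player_orders (N - {j}). ?M (N - {j}) \<tau>)"
        using False assms j
        by (intro sum.cong) (auto simp: predecessors_insert_last)
      then show ?thesis using False card[OF j] by (simp add: shapley_value_def)
    qed
  qed
  also have "\<dots> = fact m * (v N - v (N - {i}) + (\<Sum>j\<in>N - {i}. shapley_value (N - {j}) v i))"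
    using assms by (simp add: sum_distrib_left[symmetric] sum.remove[of N i])
  finally have S: "(\<Sum>\<sigma>\<in>player_orders N. ?M N \<sigma>) =
      fact m * (v N - v (N - {i}) + (\<Sum>j\<in>N - {i}. shapley_value (N - {j}) v i))" .
  have c: "real (card (player_orders N)) = real (Suc m) * fact m"
    using card_player_orders[OF assms(1)] m by (simp add: algebra_simps)
  show ?thesis
    unfolding shapley_value_def[of N] S c m by simp
qed

text \<open>Summing the recursion over \<open>i\<close> and exchanging the double sum leaves, by
  induction, the worths \<open>v (N - {j})\<close>, which cancel against those subtracted in the
  contributions of the last players.\<close>

lemma shapley_value_efficient:
  assumes "finite N"
  shows "(\<Sum>i\<in>N. shapley_value N v i) = v N - v {}"
  using assms
proof (induction "card N" arbitrary: N)
  case 0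
  then show ?case by simp
next
  case (Suc m)
  have "real (Suc m) * (\<Sum>i\<in>N. shapley_value N v i) =
      (\<Sum>i\<in>N. v N - v (N - {i}) + (\<Sum>j\<in>N - {i}. shapley_value (N - {j}) v i))"
    unfolding sum_distrib_left Suc.hyps(2)
    using Suc.prems by (intro sum.cong refl shapley_value_recursion)
  also have "\<dots> = (\<Sum>i\<in>N. v N - v (N - {i})) +
      (\<Sum>i\<in>N. \<Sum>j\<in>N - {i}. shapley_value (N - {j}) v i)"
    by (rule sum.distrib)
  \<comment> \<open>Expressing the inner range by the relation \<open>i \<noteq> j\<close> allows
    the dependent double sum to be exchanged.\<close>
  also have "(\<Sum>i\<in>N. \<Sum>j\<in>N - {i}. shapley_value (N - {j}) v i) =
      (\<Sum>i\<in>N. \<Sum>j | j \<in> N \<and> i \<noteq> j. shapley_value (N - {j}) v i)"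
    by (intro sum.cong) auto
  also have "\<dots> = (\<Sum>j\<in>N. \<Sum>i | i \<in> N \<and> i \<noteq> j. shapley_value (N - {j}) v i)"
    by (rule sum.swap_restrict[OF Suc.prems Suc.prems])
  also have "\<dots> = (\<Sum>j\<in>N. \<Sum>i\<in>N - {j}. shapley_value (N - {j}) v i)"
    by (intro sum.cong) auto
  also have "\<dots> = (\<Sum>j\<in>N. v (N - {j}) - v {})"
    using Suc.hyps(2) Suc.prems by (intro sum.cong refl Suc.hyps(1)) auto
  also have "(\<Sum>i\<in>N. v N - v (N - {i})) + (\<Sum>j\<in>N. v (N - {j}) - v {}) =
      real (Suc m) * (v N - v {})"
    using Suc.hyps(2) by (simp add: sum_subtractf algebra_simps)
  finally show ?case
    by (simp del: of_nat_Suc)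
qed

text \<open>By the recursion, \<open>card N\<close> times the left-hand side is
  \<open>v N - v (N - {i}) - v (N - {j}) + v (N - {i, j})\<close>, which is symmetric in
  \<open>i\<close> and \<open>j\<close>, plus the corresponding differences for each
  \<open>N - {k}\<close>, to which induction applies.\<close>

lemma shapley_value_balanced_contributions:
  assumes "finite N" "i \<in> N" "j \<in> N" "i \<noteq> j"
  shows "shapley_value N v i - shapley_value (N - {j}) v i =
    shapley_value N v j - shapley_value (N - {i}) v j"
  using assms
proof (induction "card N" arbitrary: N)
  case 0
  then show ?case by simp
next
  case (Suc m)
  note fin = Suc.prems(1) and ij = Suc.prems(2-4)
  let ?S = shapley_value
  have rec: "real (Suc m) * ?S N v a =
      v N - v (N - {a}) + ?S (N - {b}) v a + (\<Sum>k\<in>N - {a, b}. ?S (N - {k}) v a)"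
    if ab: "a \<in> N" "b \<in> N" "a \<noteq> b" for a b
  proof -
    have "(\<Sum>k\<in>N - {a}. ?S (N - {k}) v a) =
        ?S (N - {b}) v a + (\<Sum>k\<in>N - {a} - {b}. ?S (N - {k}) v a)"
      using fin ab by (intro sum.remove) auto
    moreover have "N - {a} - {b} = N - {a, b}" by blast
    ultimately show ?thesis
      using shapley_value_recursion[OF fin ab(1), of v] Suc.hyps(2) by simp
  qed
  \<comment> \<open>The factor is \<open>m\<close> here and \<open>Suc m\<close> in
    \<open>rec\<close>; the term for \<open>N - {b}\<close> split off in \<open>rec\<close> makes up
    the difference. Deletions are reordered to match the induction hypothesis at
    \<open>N - {k}\<close>.\<close>
  have rec': "real m * ?S (N - {b}) v a =
      v (N - {b}) - v (N - {a, b}) + (\<Sum>k\<in>N - {a, b}. ?S (N - {k} - {b}) v a)"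
    if ab: "a \<in> N" "b \<in> N" "a \<noteq> b" for a b
  proof -
    have "card (N - {b}) = m"
      using ab fin Suc.hyps(2) by simp
    moreover have "N - {b} - {a} = N - {a, b}" by blast
    moreover have "(\<Sum>k\<in>N - {a, b}. ?S (N - {b} - {k}) v a) =
        (\<Sum>k\<in>N - {a, b}. ?S (N - {k} - {b}) v a)"
      by (simp only: Diff_insert2[symmetric] insert_commute)
    ultimately show ?thesis
      using shapley_value_recursion[of "N - {b}" a v] ab fin by simp
  qed
  have "(\<Sum>k\<in>N - {i, j}. ?S (N - {k}) v i - ?S (N - {k} - {j}) v i) =
      (\<Sum>k\<in>N - {i, j}. ?S (N - {k}) v j - ?S (N - {k} - {i}) v j)"
  proof (rule sum.cong[OF refl])
    fix k assume "k \<in> N - {i, j}"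
    then show "?S (N - {k}) v i - ?S (N - {k} - {j}) v i = ?S (N - {k}) v j - ?S (N - {k} - {i}) v j"
      using Suc.hyps(2) fin ij by (intro Suc.hyps(1)) auto
  qed
  moreover have "N - {j, i} = N - {i, j}" by blast
  ultimately have "real (Suc m) * (?S N v i - ?S (N - {j}) v i) =
      real (Suc m) * (?S N v j - ?S (N - {i}) v j)"
    using rec[of i j] rec[of j i] rec'[of i j] rec'[of j i] ij
    by (simp add: sum_subtractf algebra_simps)
  then show ?case by (simp del: of_nat_Suc)
qed

text \<open>Since \<open>i\<close> is a null player of \<open>w\<close>, its marginal contributions
  in \<open>v\<close> are those in \<open>u\<close>. This lets a hyperlink ignore the part of the
  game earned outside its component.\<close>

lemma shapley_value_add_null:
  assumes "i \<in> N"
    and "\<And>S. S \<subseteq> N \<Longrightarrow> v S = u S + w S"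
    and "\<And>S. S \<subseteq> N \<Longrightarrow> w (insert i S) = w S"
  shows "shapley_value N v i = shapley_value N u i"
proof -
  have "v (predecessors N \<sigma> i \<union> {i}) - v (predecessors N \<sigma> i) =
      u (predecessors N \<sigma> i \<union> {i}) - u (predecessors N \<sigma> i)" for \<sigma>
  proof -
    have "predecessors N \<sigma> i \<subseteq> N" by (auto simp: predecessors_def)
    then show ?thesis using assms by simp
  qed
  then show ?thesis by (simp add: shapley_value_def)
qed

lemma shapley_value_cong:
  assumes "i \<in> N" "\<And>S. S \<subseteq> N \<Longrightarrow> v S = u S"
  shows "shapley_value N v i = shapley_value N u i"
  using assms by (intro shapley_value_add_null[where w = "\<lambda>_. 0"]) auto

lemma shapley_value_null:
  assumes "i \<in> N" "\<And>S. S \<subseteq> N \<Longrightarrow> v (insert i S) = v S"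
  shows "shapley_value N v i = 0"
  using shapley_value_add_null[of i N v "\<lambda>_. 0" v] assms by (simp add: shapley_value_def)

section \<open>Components of a hypergraph\<close>

text \<open>The connectivity class of \<open>i\<close>. Reflexivity holds on the whole type, so a
  point outside \<open>N\<close> forms a class of its own.\<close>

definition component_of :: "'a set \<Rightarrow> 'a set set \<Rightarrow> 'a \<Rightarrow> 'a set" where
  "component_of N H i = {j. connected_nodes N H i j}"

lemma connected_nodes_refl: "connected_nodes N H i i"
  by (simp add: connected_nodes_def)

lemma connected_nodes_trans:
  "connected_nodes N H i j \<Longrightarrow> connected_nodes N H j k \<Longrightarrow> connected_nodes N H i k"
  by (simp add: connected_nodes_def)

lemma connected_nodes_sym:
  assumes "connected_nodes N H i j"
  shows "connected_nodes N H j i"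
proof -
  have "symp (adjacent_nodes N H)"
    by (auto simp: symp_def adjacent_nodes_def)
  then show ?thesis
    using assms by (metis connected_nodes_def symp_rtranclp sympD)
qed

lemma component_of_subset: "i \<in> N \<Longrightarrow> component_of N H i \<subseteq> N"
  unfolding component_of_def connected_nodes_def
  by (auto elim: rtranclp.cases simp: adjacent_nodes_def)

lemma component_of_self: "i \<in> component_of N H i"
  by (simp add: component_of_def connected_nodes_refl)

lemma component_of_eq: "j \<in> component_of N H i \<Longrightarrow> component_of N H j = component_of N H i"
  unfolding component_of_def
  using connected_nodes_trans connected_nodes_sym by fast

lemma pairwise_connected_component_of:
  "i \<in> N \<Longrightarrow> pairwise_connected N H (component_of N H i)"
  unfolding pairwise_connected_def
  using component_of_subset component_of_eq by (fastforce simp: component_of_def)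

text \<open>For empty \<open>N\<close> the left-hand side is the set containing the empty set only.\<close>

lemma node_components_eq:
  assumes "N \<noteq> {}"
  shows "node_components N H = component_of N H ` N"
proof
  show "node_components N H \<subseteq> component_of N H ` N"
  proof
    fix T assume T: "T \<in> node_components N H"
    \<comment> \<open>The empty set is not maximal: the class of any node properly contains
      it.\<close>
    have "T \<noteq> {}"
    proof
      assume "T = {}"
      moreover obtain i where "i \<in> N" using assms by blast
      ultimately have "component_of N H i = {}"
        using T pairwise_connected_component_of[of i N H] by (auto simp: node_components_def)
      then show False
        using component_of_self[of i N H] by simp
    qed
    then obtain i where i: "i \<in> T" by blast
    with T have "i \<in> N" "T \<subseteq> component_of N H i"
      by (auto simp: node_components_def pairwise_connected_def component_of_def)
    with T have "T = component_of N H i"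
      using pairwise_connected_component_of[of i N H] by (auto simp: node_components_def)
    with \<open>i \<in> N\<close> show "T \<in> component_of N H ` N" by blast
  qed
  show "component_of N H ` N \<subseteq> node_components N H"
  proof
    fix T assume "T \<in> component_of N H ` N"
    then obtain i where i: "i \<in> N" "T = component_of N H i" by blast
    have "S = T" if "T \<subseteq> S" "pairwise_connected N H S" for S
      using that i component_of_self[of i N H]
      by (auto simp: pairwise_connected_def component_of_def)
    then show "T \<in> node_components N H"
      using i pairwise_connected_component_of by (auto simp: node_components_def)
  qed
qed

lemma component_of_unlinked:
  assumes "links_of H i = {}"
  shows "component_of N H i = {i}"
proof -
  have "j = i" if "connected_nodes N H i j" for j
    using that unfolding connected_nodes_def
    by (induction rule: rtranclp_induct) (use assms in \<open>auto simp: adjacent_nodes_def links_of_def\<close>)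
  then show ?thesis
    by (auto simp: component_of_def connected_nodes_refl)
qed

section \<open>Link-closed sets of nodes and the splitting of the hyperlink game\<close>

text \<open>For \<open>H \<subseteq> Pow N\<close> and \<open>U \<subseteq> N\<close> these are the
  unions of components. Unlike being a component, the property survives the deletion of links, so it
  holds for every coalition of the hyperlink game.\<close>

definition link_closed :: "'a set set \<Rightarrow> 'a set \<Rightarrow> bool" where
  "link_closed H U \<longleftrightarrow> (\<forall>e\<in>H. e \<inter> U \<noteq> {} \<longrightarrow> e \<subseteq> U)"

lemma link_closed_subset: "link_closed H U \<Longrightarrow> K \<subseteq> H \<Longrightarrow> link_closed K U"
  by (auto simp: link_closed_def)

lemma link_closed_component_of:
  assumes "H \<subseteq> Pow N"
  shows "link_closed H (component_of N H i)"
proof -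
  have "k \<in> component_of N H i" if "e \<in> H" "j \<in> e" "j \<in> component_of N H i" "k \<in> e" for e j k
  proof -
    have "adjacent_nodes N H j k"
      using that assms by (auto simp: adjacent_nodes_def)
    with that show ?thesis
      by (simp add: component_of_def connected_nodes_def)
  qed
  then show ?thesis by (auto simp: link_closed_def)
qed

lemma link_closed_Diff: "H \<subseteq> Pow N \<Longrightarrow> link_closed H U \<Longrightarrow> link_closed H (N - U)"
  unfolding link_closed_def by blast

text \<open>A walk starting in \<open>U\<close> never leaves it, hence uses only links that meet
  \<open>U\<close>, and these belong to \<open>L\<close>. Two opposite applications give equality of
  classes; \<open>L = K\<close> shows that classes stay inside \<open>U\<close>.\<close>

lemma component_of_local_subset:
  assumes "link_closed K U" "\<And>e. e \<in> K \<Longrightarrow> e \<inter> U \<noteq> {} \<Longrightarrow> e \<in> L" "i \<in> U"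
  shows "component_of N K i \<subseteq> component_of N L i \<inter> U"
proof -
  have "connected_nodes N L i j \<and> j \<in> U" if "connected_nodes N K i j" for j
    using that unfolding connected_nodes_def
  proof (induction rule: rtranclp_induct)
    case base
    then show ?case using assms(3) by simp
  next
    case (step j k)
    then obtain e where e: "e \<in> K" "j \<in> e" "k \<in> e" "j \<in> N" "k \<in> N"
      by (auto simp: adjacent_nodes_def)
    then have "e \<in> L" "k \<in> U"
      using assms step by (auto simp: link_closed_def)
    then have "adjacent_nodes N L j k"
      using e by (auto simp: adjacent_nodes_def)
    then show ?case
      using step \<open>k \<in> U\<close> by auto
  qed
  then show ?thesis by (auto simp: component_of_def)
qed

lemma component_of_insert_disjoint:
  assumes "link_closed K U" "e \<inter> U = {}" "i \<in> U"
  shows "component_of N (insert e K) i = component_of N K i"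
proof
  have "link_closed (insert e K) U"
    using assms by (auto simp: link_closed_def)
  then show "component_of N (insert e K) i \<subseteq> component_of N K i"
    using component_of_local_subset[of "insert e K" U K i N] assms by auto
  show "component_of N K i \<subseteq> component_of N (insert e K) i"
    using component_of_local_subset[of K U "insert e K" i N] assms by auto
qed

text \<open>The part of the hyperlink game earned inside \<open>U\<close>, when \<open>U\<close> is
  link-closed for \<open>K\<close>. Summing over an image counts each component once.\<close>

definition local_game ::
  "'a set \<Rightarrow> ('a set \<Rightarrow> real) \<Rightarrow> 'a set \<Rightarrow> 'a set set \<Rightarrow> real" where
  "local_game N v U K = (\<Sum>T\<in>component_of N K ` U. v T)"

lemma local_game_insert_disjoint:
  assumes "link_closed K U" "e \<inter> U = {}"
  shows "local_game N v U (insert e K) = local_game N v U K"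
proof -
  have "component_of N (insert e K) ` U = component_of N K ` U"
    using component_of_insert_disjoint[OF assms] by (intro image_cong) auto
  then show ?thesis by (simp add: local_game_def)
qed

text \<open>Classes of nodes in \<open>U\<close> stay in \<open>U\<close>, while the class of a node
  outside \<open>U\<close> contains that node; so the two families of components are
  disjoint.\<close>

lemma hyperlink_game_split:
  assumes "finite N" "N \<noteq> {}" "U \<subseteq> N" "link_closed H U" "K \<subseteq> H"
  shows "hyperlink_game N v H K = local_game N v U K + local_game N v (N - U) K"
proof -
  have "component_of N K i \<subseteq> U" if "i \<in> U" for i
    using component_of_local_subset[of K U K i N] link_closed_subset assms that by blast
  then have "component_of N K ` U \<inter> component_of N K ` (N - U) = {}"
    using component_of_self by fastforce
  moreover have "component_of N K ` N = component_of N K ` U \<union> component_of N K ` (N - U)"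
    using assms by blast
  ultimately show ?thesis
    using assms finite_subset[OF assms(3,1)]
    by (simp add: hyperlink_game_def node_components_eq local_game_def sum.union_disjoint)
qed

section \<open>Properties of the position value\<close>

lemma HCS_D:
  assumes "(v, H) \<in> HCS N"
  shows "finite N" "v {} = 0" "i \<in> N \<Longrightarrow> v {i} = 0" "H \<subseteq> Pow N" "finite H"
    "e \<in> H \<Longrightarrow> card e > 1"
proof -
  show "finite N" and *: "H \<subseteq> Pow N"
    using assms by (auto simp: HCS_def tu_game_def)
  then show "finite H" by (auto intro: finite_subset)
qed (use assms in \<open>auto simp: HCS_def tu_game_def zero_normalized_def\<close>)

lemma HCS_remove_link: "(v, H) \<in> HCS N \<Longrightarrow> (v, H - {e}) \<in> HCS N"
  by (auto simp: HCS_def)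

lemma position_value_eq:
  "(v, H) \<in> HCS N \<Longrightarrow> i \<in> N \<Longrightarrow> position_value N (v, H) i =
    (\<Sum>e\<in>links_of H i. (1 / real (card e)) * shapley_value H (hyperlink_game N v H) e)"
  by (simp add: position_value_def)

text \<open>Double counting: a hyperlink inside \<open>U\<close> gives \<open>1 / card e\<close> of
  its value to each of its \<open>card e\<close> members, and by closedness every other hyperlink
  misses \<open>U\<close>.\<close>

lemma sum_links_of_closed:
  fixes g :: "'a set \<Rightarrow> real"
  assumes "finite H" "finite U" "link_closed H U" "\<And>e. e \<in> H \<Longrightarrow> card e > 1"
  shows "(\<Sum>i\<in>U. \<Sum>e\<in>links_of H i. (1 / real (card e)) * g e) = (\<Sum>e | e \<in> H \<and> e \<subseteq> U. g e)"
proof -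
  have "(\<Sum>i\<in>U. \<Sum>e\<in>links_of H i. (1 / real (card e)) * g e) =
      (\<Sum>e\<in>H. \<Sum>i | i \<in> U \<and> i \<in> e. (1 / real (card e)) * g e)"
    unfolding links_of_def by (rule sum.swap_restrict[OF assms(2,1)])
  also have "\<dots> = (\<Sum>e\<in>H. if e \<subseteq> U then g e else 0)"
  proof (rule sum.cong[OF refl])
    fix e assume e: "e \<in> H"
    show "(\<Sum>i | i \<in> U \<and> i \<in> e. (1 / real (card e)) * g e) = (if e \<subseteq> U then g e else 0)"
    proof (cases "e \<subseteq> U")
      case True
      then have "{i. i \<in> U \<and> i \<in> e} = e" by auto
      then show ?thesis using True assms(4)[OF e] by simp
    next
      case False
      then have "{i. i \<in> U \<and> i \<in> e} = {}" using assms(3) e by (auto simp: link_closed_def)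
      then show ?thesis using False by (simp only: sum.empty if_False)
    qed
  qed
  also have "\<dots> = (\<Sum>e | e \<in> H \<and> e \<subseteq> U. g e)"
    using assms(1) by (simp add: sum.inter_filter)
  finally show ?thesis .
qed

lemma position_value_component_efficient:
  assumes "N \<noteq> {}"
  shows "component_efficient N (position_value N)"
  unfolding component_efficient_def
proof (clarify)
  fix v H T assume HC: "(v, H) \<in> HCS N" and T: "T \<in> node_components N H"
  note D = HCS_D[OF HC]
  obtain t where t: "t \<in> N" "T = component_of N H t"
    using T assms by (auto simp: node_components_eq)
  have TN: "T \<subseteq> N" using t component_of_subset by metis
  have finT: "finite T" using TN D(1) finite_subset by blast
  have cl: "link_closed H T" using link_closed_component_of[OF D(4)] t(2) by simp
  have cl': "link_closed H (N - T)" using link_closed_Diff[OF D(4) cl] .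
  let ?h = "local_game N v T"
  have "(\<Sum>i\<in>T. position_value N (v, H) i) =
      (\<Sum>i\<in>T. \<Sum>e\<in>links_of H i. (1 / real (card e)) * shapley_value H (hyperlink_game N v H) e)"
    using TN by (intro sum.cong) (auto simp: position_value_eq[OF HC])
  also have "\<dots> = (\<Sum>e | e \<in> H \<and> e \<subseteq> T. shapley_value H (hyperlink_game N v H) e)"
    using D finT cl by (intro sum_links_of_closed) auto
  \<comment> \<open>A link inside \<open>T\<close> is a null player of the game played outside
    \<open>T\<close>.\<close>
  also have "\<dots> = (\<Sum>e | e \<in> H \<and> e \<subseteq> T. shapley_value H ?h e)"
  proof (rule sum.cong[OF refl])
    fix e assume e: "e \<in> {e. e \<in> H \<and> e \<subseteq> T}"
    show "shapley_value H (hyperlink_game N v H) e = shapley_value H ?h e"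
    proof (rule shapley_value_add_null)
      show "e \<in> H" using e by simp
      show "hyperlink_game N v H K = ?h K + local_game N v (N - T) K" if "K \<subseteq> H" for K
        using hyperlink_game_split[OF D(1) assms TN cl that] .
      show "local_game N v (N - T) (insert e K) = local_game N v (N - T) K" if "K \<subseteq> H" for K
        using e that link_closed_subset[OF cl'] by (intro local_game_insert_disjoint) auto
    qed
  qed
  \<comment> \<open>Conversely, links outside \<open>T\<close> are null players of the local game;
    including them makes efficiency applicable.\<close>
  also have "\<dots> = (\<Sum>e\<in>H. shapley_value H ?h e)"
  proof (rule sum.mono_neutral_left)
    show "\<forall>e\<in>H - {e. e \<in> H \<and> e \<subseteq> T}. shapley_value H ?h e = 0"
    proof
      fix e assume e: "e \<in> H - {e. e \<in> H \<and> e \<subseteq> T}"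
      then have "e \<inter> T = {}" using cl by (auto simp: link_closed_def)
      then show "shapley_value H ?h e = 0"
        using e link_closed_subset[OF cl]
        by (intro shapley_value_null local_game_insert_disjoint) auto
    qed
  qed (use D in auto)
  also have "\<dots> = ?h H - ?h {}"
    using D by (intro shapley_value_efficient)
  also have "?h H = v T"
  proof -
    have "component_of N H ` T = {T}"
      using t component_of_eq component_of_self by (fastforce simp: image_iff)
    then show ?thesis by (simp add: local_game_def)
  qed
  \<comment> \<open>Without links all components are singletons, worth 0 by
    zero-normalization.\<close>
  also have "?h {} = 0"
  proof -
    have "component_of N {} i = {i}" for i
      by (intro component_of_unlinked) (simp add: links_of_def)
    then show ?thesis
      using D(3) TN by (auto simp: local_game_def intro!: sum.neutral)
  qed
  finally show "(\<Sum>i\<in>T. position_value N (v, H) i) = v T" by simp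
qed

text \<open>Both sides are the sum of \<open>d e e' / (card e * card e')\<close> over the links of
  one player and those of the other, and \<open>d\<close> is symmetric by balanced
  contributions.\<close>

lemma position_value_balanced:
  "partial_balanced_conference_contributions N (position_value N)"
  unfolding partial_balanced_conference_contributions_def
proof (clarify)
  fix v H i j assume HC: "(v, H) \<in> HCS N" and ij: "i \<in> N" "j \<in> N"
  note D = HCS_D[OF HC]
  let ?g = "hyperlink_game N v H"
  \<comment> \<open>The change in the share of \<open>e'\<close> when \<open>e\<close> is deleted. A
    deleted link has no share left, whence the value 0 for \<open>e' = e\<close>.\<close>
  define d where "d e e' = shapley_value H ?g e' - (if e' = e then 0 else shapley_value (H - {e}) ?g e')"
    for e e'
  have fin: "finite (links_of H k)" for k
    using D by (simp add: links_of_def)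
  have d_sym: "d e e' = d e' e" if "e \<in> H" "e' \<in> H" for e e'
    using shapley_value_balanced_contributions[of H e e' ?g] D that by (auto simp: d_def)
  have diff: "position_value N (v, H) k - position_value N (v, H - {e}) k =
      (\<Sum>e'\<in>links_of H k. (1 / real (card e')) * d e e')" if "k \<in> N" for k e
  proof -
    have "position_value N (v, H - {e}) k = (\<Sum>e'\<in>links_of (H - {e}) k.
        (1 / real (card e')) * shapley_value (H - {e}) (hyperlink_game N v (H - {e})) e')"
      using HCS_remove_link[OF HC] that by (rule position_value_eq)
    \<comment> \<open>The worth of a set of links does not depend on the ambient \<open>H\<close>,
      so deleting \<open>e\<close> yields a subgame of \<open>?g\<close>.\<close>
    also have "\<dots> = (\<Sum>e'\<in>links_of (H - {e}) k. (1 / real (card e')) * shapley_value (H - {e}) ?g e')"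
    proof (intro sum.cong refl arg_cong2[where f = "(*)"] shapley_value_cong)
      show "hyperlink_game N v (H - {e}) K = ?g K" if "K \<subseteq> H - {e}" for K
        using that by (auto simp: hyperlink_game_def)
    qed (auto simp: links_of_def)
    also have "\<dots> = (\<Sum>e'\<in>links_of H k.
        (1 / real (card e')) * (if e' = e then 0 else shapley_value (H - {e}) ?g e'))"
      using fin by (intro sum.mono_neutral_cong_left) (auto simp: links_of_def)
    finally show ?thesis
      using that by (simp add: position_value_eq[OF HC] d_def sum_subtractf[symmetric] diff_divide_distrib)
  qed
  have "(\<Sum>e\<in>links_of H j. (1 / real (card e)) *
        (position_value N (v, H) i - position_value N (v, H - {e}) i)) =
      (\<Sum>e\<in>links_of H j. \<Sum>e'\<in>links_of H i. (1 / real (card e)) * ((1 / real (card e')) * d e e'))"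
    unfolding diff[OF ij(1)] sum_distrib_left ..
  also have "\<dots> = (\<Sum>e'\<in>links_of H i. \<Sum>e\<in>links_of H j. (1 / real (card e)) * ((1 / real (card e')) * d e e'))"
    by (rule sum.swap)
  also have "\<dots> = (\<Sum>e'\<in>links_of H i. \<Sum>e\<in>links_of H j. (1 / real (card e')) * ((1 / real (card e)) * d e' e))"
    using d_sym by (intro sum.cong refl) (auto simp: links_of_def)
  also have "\<dots> = (\<Sum>e\<in>links_of H i. (1 / real (card e)) *
        (position_value N (v, H) j - position_value N (v, H - {e}) j))"
    unfolding diff[OF ij(2)] sum_distrib_left ..
  finally show "(\<Sum>e\<in>links_of H j. (1 / real (card e)) *
        (position_value N (v, H) i - position_value N (v, H - {e}) i)) =
      (\<Sum>e\<in>links_of H i. (1 / real (card e)) *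
        (position_value N (v, H) j - position_value N (v, H - {e}) j))" .
qed

section \<open>Uniqueness\<close>

lemma allocation_unique:
  assumes "N \<noteq> {}"
    and f: "component_efficient N f" "partial_balanced_conference_contributions N f"
    and g: "component_efficient N g" "partial_balanced_conference_contributions N g"
    and "(v, H) \<in> HCS N" "j \<in> N"
  shows "f (v, H) j = g (v, H) j"
  using assms(6,7)
proof (induction "card H" arbitrary: H j rule: less_induct)
  case less
  note HC = less.prems(1) and D = HCS_D[OF less.prems(1)]
  define d where "d i = f (v, H) i - g (v, H) i" for i
  define w where "w i = (\<Sum>e\<in>links_of H i. 1 / real (card e))" for i
  have IH: "f (v, H - {e}) i = g (v, H - {e}) i" if "e \<in> H" "i \<in> N" for e i
    using less.hyps[of "H - {e}" i] HCS_remove_link[OF HC] card_Diff1_less[OF D(5)] that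
    by blast
  have fin: "finite (links_of H k)" for k
    using D by (simp add: links_of_def)
  \<comment> \<open>After deletion of a link the two rules agree by induction, so subtracting their
    balance equations leaves only the weighted differences at \<open>H\<close>.\<close>
  have proportional: "w k * d i = w i * d k" if "i \<in> N" "k \<in> N" for i k
  proof -
    have wd: "w b * d a =
        (\<Sum>e\<in>links_of H b. (1 / real (card e)) * (f (v, H) a - f (v, H - {e}) a)) -
        (\<Sum>e\<in>links_of H b. (1 / real (card e)) * (g (v, H) a - g (v, H - {e}) a))" if "a \<in> N" for a b
      unfolding w_def sum_distrib_right sum_subtractf[symmetric]
      using IH that by (intro sum.cong) (auto simp: d_def links_of_def diff_divide_distrib)
    show ?thesis
      using f(2) g(2) HC that
      unfolding wd[OF that(1)] wd[OF that(2)] partial_balanced_conference_contributions_def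
      by fastforce
  qed
  let ?T = "component_of N H j"
  have TN: "?T \<subseteq> N" using component_of_subset less.prems by metis
  then have finT: "finite ?T" using D(1) finite_subset by blast
  have "?T \<in> node_components N H"
    using less.prems assms(1) by (simp add: node_components_eq)
  then have "(\<Sum>i\<in>?T. f (v, H) i) = v ?T" "(\<Sum>i\<in>?T. g (v, H) i) = v ?T"
    using f(1) g(1) HC by (auto simp: component_efficient_def)
  then have sum0: "(\<Sum>i\<in>?T. d i) = 0"
    by (simp add: d_def sum_subtractf)
  show ?case
  proof (cases "links_of H j = {}")
    case True
    then show ?thesis
      using sum0 by (simp add: component_of_unlinked d_def)
  next
    case False
    have "0 < w j"
      unfolding w_def using fin False D(6) by (intro sum_pos) (auto simp: links_of_def intro: order.strict_trans[OF zero_less_one])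
    also have "w j \<le> (\<Sum>i\<in>?T. w i)"
      using finT component_of_self by (intro member_le_sum) (auto simp: w_def intro: sum_nonneg)
    finally have pos: "(\<Sum>i\<in>?T. w i) > 0" .
    \<comment> \<open>Proportionality replaces each \<open>w i * d j\<close> by
      \<open>w j * d i\<close>, and the differences sum to 0 over the component.\<close>
    have "(\<Sum>i\<in>?T. w i) * d j = (\<Sum>i\<in>?T. w j * d i)"
      unfolding sum_distrib_right using proportional TN less.prems by (intro sum.cong) auto
    also have "\<dots> = 0"
      using sum0 by (simp add: sum_distrib_left[symmetric])
    finally show ?thesis
      using pos by (simp add: d_def)
  qed
qed

text \<open>Rules are extensional at both levels, so they take the same default values outside
  \<open>HCS N\<close> and outside \<open>N\<close>.\<close>

lemma allocation_rules_eqI: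
  assumes "f \<in> allocation_rules N" "g \<in> allocation_rules N"
    and "\<And>v H i. (v, H) \<in> HCS N \<Longrightarrow> i \<in> N \<Longrightarrow> f (v, H) i = g (v, H) i"
  shows "f = g"
proof (rule PiE_ext)
  show "f p = g p" if p: "p \<in> HCS N" for p
  proof (rule PiE_ext)
    show "f p \<in> N \<rightarrow>\<^sub>E UNIV" "g p \<in> N \<rightarrow>\<^sub>E UNIV"
      using assms(1,2) p by (auto simp: allocation_rules_def)
    show "f p i = g p i" if "i \<in> N" for i
      using assms(3) p that by (cases p) auto
  qed
qed (use assms in \<open>auto simp: allocation_rules_def\<close>)

lemma position_value_allocation_rule: "position_value N \<in> allocation_rules N"
  unfolding allocation_rules_def position_value_def
  by (auto intro!: restrict_PiE)

theorem theorem3p3: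
  fixes n :: nat
    and f :: "(nat set \<Rightarrow> real) \<times> nat set set \<Rightarrow> nat \<Rightarrow> real"
  assumes "n \<ge> 2"
  shows "f \<in> allocation_rules {1..n} \<and> component_efficient {1..n} f \<and>
           partial_balanced_conference_contributions {1..n} f
         \<longleftrightarrow> f = position_value {1..n}"
proof -
  have ne: "{1..n} \<noteq> {}" using assms by simp
  note pv = position_value_allocation_rule position_value_component_efficient[OF ne]
    position_value_balanced
  show ?thesis
    using pv allocation_rules_eqI allocation_unique[OF ne _ _ pv(2,3)] by metis
qed

end
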